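(* Let $F$ be a Boolean circuit, let $(T,\mathbf{G})$ be a type-respecting simplified clique decomposition of $F$, and let $F^*$ be the circuit constructed from $F$ and $(T,\mathbf{G})$ as described in the context. Then $F^*$ is a well-formed (in particular acyclic) circuit, and the output of each original gate $g$ of $F^*$ computes exactly the same Boolean function of the input variables as $g$ computes in $F$ ($F$ and $F^*$ have the same input gates).
   Context: Boolean circuits are over $\{\vee,\wedge,\neg\}$: input gates (no inputs), NOT gates (one input), AND/OR gates (positive fan-in), no constant gates; "a wire from $g_1$ to $g_2$" means the output of $g_1$ feeds an input of $g_2$; the DAG of a circuit has an arc per wire. A labeled directed graph is $(V,E,\mathbf{S})$ with $\mathbf{S}$ a partition of $V$ into labels. A simplified clique decomposition (SCD) $(T,\mathbf{G})$: rooted tree $T$, each node having at most two children, each node $t$ carrying a labeled directed graph $G(t)$; a leaf carries $(\{v\},\emptyset,\{\{v\}\})$; a node with two children carries the union of the vertex-disjoint graphs of its children; a node with one child $t_1$ carries $G(t_1)$ modified by (i) adding a new vertex $v$ as singleton label, or (ii) union of two labels $S_1,S_2$ into $S=S_1\cup S_2$ ($S_1,S_2$ are then the children of $S$), or (iii) new adjacency: adding all arcs from every vertex of label $S_1$ to every vertex of label $S_2$ (we then say there is an arc from $S_1$ to $S_2$). The set of labels of $(T,\mathbf{G})$ is $\bigcup_t \mathbf{S}(G(t))$; its width is $\max_t|\mathbf{S}(G(t))|$; it is an SCD of $F$ if the unlabeled graph at the root is the DAG of $F$. It is type-respecting if each non-singleton label is a unary label (only input and NOT gates), an AND label (only AND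 gates) or an OR label (only OR gates); a singleton label $\{g\}$ has the type of $g$ (input or NOT gate: unary). Construction of $F^*$. Gates: each singleton label $\{g\}$ is associated with the gate $g$ of $F$ (an original gate), and we set $oand(\{g\})=oor(\{g\})=in(\{g\})=g$. Each non-singleton label $S$ gets a new AND gate $oand(S)$ and a new OR gate $oor(S)$, and, if $S$ contains no input gates, a further gate $in(S)$ which is an AND gate if $S$ is an AND label, an OR gate if $S$ is an OR label, and, if $S$ is unary, a chain of two NOT gates (input of the first is the input of $in(S)$, output of the second is the output of $in(S)$). Wires: (child-parent) if $S_1$ is a child of $S_2$, wires from $oand(S_1)$ to $oand(S_2)$ and from $oor(S_1)$ to $oor(S_2)$; (parent-child) if $S_1$ is a child of $S_2$ and $S_2$ contains no input gates, a wire from $in(S_2)$ to $in(S_1)$; (adjacency) if there is an arc from $S_1$ to $S_2$: a wire from $oand(S_1)$ to $in(S_2)$ if $S_2$ is an AND label, from $oor(S_1)$ to $in(S_2)$ if $S_2$ is an OR label, and from one arbitrary of $oand(S_1),oor(S_1)$ to $in(S_2)$ if $S_2$ is a unary label consisting of NOT gates only. Finally, $in(S)$ gates having no inputs are removed, iteratively.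
   Formalization: Arcs and wires are counted with multiplicity: a new adjacency between already adjacent vertices adds parallel arcs, so each NOT gate's input wire comes from one adjacency step; if re-adding an arc were a no-op, a NOT gate could receive two wires in F* and the claim would fail. *)

theory Defs
  imports "HOL-Library.Multiset" "HOL-Library.Disjoint_Sets"
begin

section \<open>Boolean circuits\<close>

datatype 'x gate_kind = is_Input_Gate: Input_Gate 'x | Not_Gate | And_Gate | Or_Gate

text \<open>
  An input gate carries its input variable, of type \<open>'x\<close>. A pair \<open>(g, h)\<close> in \<open>wires\<close> means that the
  output of \<open>g\<close> feeds an input of \<open>h\<close>. The wires form a multiset because gates may be joined by
  parallel wires, each of which is an arc of its own in the DAG of the circuit; in particular the
  fan-in of a gate counts wires.
\<close>

record ('g, 'x) circuit =
  gates :: "'g set"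
  kind :: "'g \<Rightarrow> 'x gate_kind"
  wires :: "('g \<times> 'g) multiset"

definition fan_in :: "('g, 'x) circuit \<Rightarrow> 'g \<Rightarrow> nat" where
  "fan_in C g = size {#e \<in># wires C. snd e = g#}"

fun fan_in_ok :: "'x gate_kind \<Rightarrow> nat \<Rightarrow> bool" where
  "fan_in_ok (Input_Gate x) n \<longleftrightarrow> n = 0"
| "fan_in_ok Not_Gate n \<longleftrightarrow> n = 1"
| "fan_in_ok And_Gate n \<longleftrightarrow> n > 0"
| "fan_in_ok Or_Gate n \<longleftrightarrow> n > 0"

definition well_formed_circuit :: "('g, 'x) circuit \<Rightarrow> bool" where
  "well_formed_circuit C \<longleftrightarrow>
     finite (gates C) \<and>
     set_mset (wires C) \<subseteq> gates C \<times> gates C \<and>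
     acyclic (set_mset (wires C)) \<and>
     (\<forall>g\<in>gates C. fan_in_ok (kind C g) (fan_in C g))"

definition input_gates :: "('g, 'x) circuit \<Rightarrow> 'g set" where
  "input_gates C = {g \<in> gates C. is_Input_Gate (kind C g)}"

definition gate_step ::
    "('g, 'x) circuit \<Rightarrow> ('x \<Rightarrow> bool) \<Rightarrow> ('g \<Rightarrow> bool) \<Rightarrow> 'g \<Rightarrow> bool" where
  "gate_step C \<alpha> val g =
     (case kind C g of
        Input_Gate x \<Rightarrow> \<alpha> x
      | Not_Gate \<Rightarrow> \<not> val (THE h. (h, g) \<in># wires C)
      | And_Gate \<Rightarrow> (\<forall>h. (h, g) \<in># wires C \<longrightarrow> val h)
      | Or_Gate \<Rightarrow> (\<exists>h. (h, g) \<in># wires C \<and> val h))"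

definition gate_value :: "('g, 'x) circuit \<Rightarrow> ('x \<Rightarrow> bool) \<Rightarrow> 'g \<Rightarrow> bool" where
  "gate_value C \<alpha> = wfrec (set_mset (wires C)) (gate_step C \<alpha>)"

definition gate_function :: "('g, 'x) circuit \<Rightarrow> 'g \<Rightarrow> ('x \<Rightarrow> bool) \<Rightarrow> bool" where
  "gate_function C g = (\<lambda>\<alpha>. gate_value C \<alpha> g)"

lemma fan_in_one_ex1:
  assumes "fan_in C g = 1"
  shows "\<exists>!h. (h, g) \<in># wires C"
proof -
  obtain e where e: "{#e \<in># wires C. snd e = g#} = {#e#}"
    using assms unfolding fan_in_def by (metis size_1_singleton_mset)
  have iff: "(h, g) \<in># wires C \<longleftrightarrow> (h, g) = e" for h
  proof -
    have "(h, g) \<in># wires C \<longleftrightarrow> (h, g) \<in># {#e \<in># wires C. snd e = g#}" by simp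
    then show ?thesis unfolding e by simp
  qed
  have "e \<in># {#e \<in># wires C. snd e = g#}" unfolding e by simp
  then have "e = (fst e, g)" by auto
  then show ?thesis using iff by (metis fst_conv)
qed

lemma gate_value_unfold:
  assumes C: "well_formed_circuit C" and g: "g \<in> gates C"
  shows "gate_value C \<alpha> g = gate_step C \<alpha> (gate_value C \<alpha>) g"
proof -
  let ?r = "set_mset (wires C)"
  have wf: "wf ?r"
    using C by (simp add: well_formed_circuit_def finite_acyclic_wf)
  have the: "((THE h. (h, g) \<in># wires C), g) \<in># wires C" if "kind C g = Not_Gate"
  proof -
    have "fan_in C g = 1" using C g that by (force simp: well_formed_circuit_def)
    from theI'[OF fan_in_one_ex1[OF this]] show ?thesis .
  qed
  have "gate_value C \<alpha> g = gate_step C \<alpha> (cut (gate_value C \<alpha>) ?r g) g"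
    unfolding gate_value_def by (rule wfrec[OF wf])
  also have "\<dots> = gate_step C \<alpha> (gate_value C \<alpha>) g"
    using the by (auto simp: gate_step_def cut_def split: gate_kind.splits)
  finally show ?thesis .
qed


section \<open>Simplified clique decompositions\<close>

text \<open>
  As the DAG of a circuit has one arc per wire, the arcs of a graph form a multiset as well: adding
  arcs between vertices that are already adjacent creates parallel arcs. This matters for NOT gates,
  whose single input wire must then be introduced by a single adjacency operation.
\<close>

record 'v labeled_graph =
  verts :: "'v set"
  arcs :: "('v \<times> 'v) multiset"
  labels :: "'v set set"

text \<open>
  The tree of a decomposition, with each inner node recording its operation: \<open>Join\<close> is a node with
  two children, \<open>Add_Vertex\<close>, \<open>Merge\<close> and \<open>Adjacency\<close> are nodes with one child. The labeled graph
  carried by a node is computed from the subtree rooted there.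
\<close>

datatype 'v scd =
  Leaf 'v
| Join "'v scd" "'v scd"
| Add_Vertex 'v "'v scd"
| Merge "'v set" "'v set" "'v scd"
| Adjacency "'v set" "'v set" "'v scd"

fun graph_at :: "'v scd \<Rightarrow> 'v labeled_graph" where
  "graph_at (Leaf v) = \<lparr>verts = {v}, arcs = {#}, labels = {{v}}\<rparr>"
| "graph_at (Join t1 t2) =
     \<lparr>verts = verts (graph_at t1) \<union> verts (graph_at t2),
      arcs = arcs (graph_at t1) + arcs (graph_at t2),
      labels = labels (graph_at t1) \<union> labels (graph_at t2)\<rparr>"
| "graph_at (Add_Vertex v t) =
     \<lparr>verts = insert v (verts (graph_at t)),
      arcs = arcs (graph_at t),
      labels = insert {v} (labels (graph_at t))\<rparr>"
| "graph_at (Merge S1 S2 t) =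
     \<lparr>verts = verts (graph_at t),
      arcs = arcs (graph_at t),
      labels = insert (S1 \<union> S2) (labels (graph_at t) - {S1, S2})\<rparr>"
| "graph_at (Adjacency S1 S2 t) =
     \<lparr>verts = verts (graph_at t),
      arcs = arcs (graph_at t) + mset_set (S1 \<times> S2),
      labels = labels (graph_at t)\<rparr>"

fun valid_scd :: "'v scd \<Rightarrow> bool" where
  "valid_scd (Leaf v) \<longleftrightarrow> True"
| "valid_scd (Join t1 t2) \<longleftrightarrow>
     valid_scd t1 \<and> valid_scd t2 \<and> verts (graph_at t1) \<inter> verts (graph_at t2) = {}"
| "valid_scd (Add_Vertex v t) \<longleftrightarrow> valid_scd t \<and> v \<notin> verts (graph_at t)"
| "valid_scd (Merge S1 S2 t) \<longleftrightarrow>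
     valid_scd t \<and> S1 \<in> labels (graph_at t) \<and> S2 \<in> labels (graph_at t) \<and> S1 \<noteq> S2"
| "valid_scd (Adjacency S1 S2 t) \<longleftrightarrow>
     valid_scd t \<and> S1 \<in> labels (graph_at t) \<and> S2 \<in> labels (graph_at t)"

text \<open>Nodes are represented by the subtrees rooted at them.\<close>

fun nodes :: "'v scd \<Rightarrow> 'v scd set" where
  "nodes (Leaf v) = {Leaf v}"
| "nodes (Join t1 t2) = insert (Join t1 t2) (nodes t1 \<union> nodes t2)"
| "nodes (Add_Vertex v t) = insert (Add_Vertex v t) (nodes t)"
| "nodes (Merge S1 S2 t) = insert (Merge S1 S2 t) (nodes t)"
| "nodes (Adjacency S1 S2 t) = insert (Adjacency S1 S2 t) (nodes t)"

definition scd_labels :: "'v scd \<Rightarrow> 'v set set" where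
  "scd_labels D = (\<Union>t\<in>nodes D. labels (graph_at t))"

definition label_child :: "'v scd \<Rightarrow> 'v set \<Rightarrow> 'v set \<Rightarrow> bool" where
  "label_child D S' S \<longleftrightarrow>
     (\<exists>S1 S2 t. Merge S1 S2 t \<in> nodes D \<and> S = S1 \<union> S2 \<and> (S' = S1 \<or> S' = S2))"

definition label_arc :: "'v scd \<Rightarrow> 'v set \<Rightarrow> 'v set \<Rightarrow> bool" where
  "label_arc D S1 S2 \<longleftrightarrow> (\<exists>t. Adjacency S1 S2 t \<in> nodes D)"

definition scd_of :: "'g scd \<Rightarrow> ('g, 'x) circuit \<Rightarrow> bool" where
  "scd_of D F \<longleftrightarrow>
     valid_scd D \<and> verts (graph_at D) = gates F \<and> arcs (graph_at D) = wires F"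

lemma valid_scd_graph:
  assumes "valid_scd D"
  shows "finite (verts (graph_at D))"
    and "partition_on (verts (graph_at D)) (labels (graph_at D))"
    and "set_mset (arcs (graph_at D)) \<subseteq> verts (graph_at D) \<times> verts (graph_at D)"
proof -
  have "finite (verts (graph_at D)) \<and> partition_on (verts (graph_at D)) (labels (graph_at D)) \<and>
        set_mset (arcs (graph_at D)) \<subseteq> verts (graph_at D) \<times> verts (graph_at D)"
    using assms
  proof (induction D)
    case (Leaf v)
    then show ?case by (auto simp: partition_on_def)
  next
    case (Join t1 t2)
    let ?V1 = "verts (graph_at t1)" and ?L1 = "labels (graph_at t1)"
    let ?V2 = "verts (graph_at t2)" and ?L2 = "labels (graph_at t2)"
    have L: "\<Union>?L1 = ?V1" "disjoint ?L1" "{} \<notin> ?L1" "\<Union>?L2 = ?V2" "disjoint ?L2" "{} \<notin> ?L2"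
      using Join by (auto simp: partition_on_def)
    have "\<Union>?L1 \<inter> \<Union>?L2 = {}" using Join.prems L(1,4) by simp
    then have "disjoint (?L1 \<union> ?L2)" using L(2,5) by (intro disjoint_union)
    then have "partition_on (?V1 \<union> ?V2) (?L1 \<union> ?L2)"
      using L by (auto simp: partition_on_def)
    with Join show ?case by auto
  next
    case (Add_Vertex v t)
    then show ?case by (auto simp: partition_on_def disjoint_def)
  next
    case (Merge S1 S2 t)
    let ?V = "verts (graph_at t)" and ?L = "labels (graph_at t)"
    have L: "\<Union>?L = ?V" "disjoint ?L" "{} \<notin> ?L" "S1 \<in> ?L" "S2 \<in> ?L"
      using Merge by (auto simp: partition_on_def)
    have "\<Union>(insert (S1 \<union> S2) (?L - {S1, S2})) = ?V" using L(1,4,5) by blast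
    moreover have "disjoint (insert (S1 \<union> S2) (?L - {S1, S2}))"
    proof -
      have "(S1 \<union> S2) \<inter> S = {}" if "S \<in> ?L - {S1, S2}" for S
        using L(4,5) disjointD[OF L(2)] that by blast
      moreover have "disjoint (?L - {S1, S2})" using L(2) by (auto simp: disjoint_def)
      ultimately show ?thesis by (auto simp: disjoint_def)
    qed
    moreover have "{} \<notin> insert (S1 \<union> S2) (?L - {S1, S2})" using L(3,4) by auto
    ultimately show ?case using Merge by (auto simp: partition_on_def)
  next
    case (Adjacency S1 S2 t)
    then have "S1 \<subseteq> verts (graph_at t)" "S2 \<subseteq> verts (graph_at t)"
      by (auto simp: partition_on_def)
    moreover from this have "finite (S1 \<times> S2)"
      using Adjacency by (auto intro: finite_subset)
    ultimately show ?case using Adjacency by auto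
  qed
  then show "finite (verts (graph_at D))"
    and "partition_on (verts (graph_at D)) (labels (graph_at D))"
    and "set_mset (arcs (graph_at D)) \<subseteq> verts (graph_at D) \<times> verts (graph_at D)" by auto
qed


section \<open>Types of labels\<close>

definition not_label :: "('g, 'x) circuit \<Rightarrow> 'g set \<Rightarrow> bool" where
  "not_label F S \<longleftrightarrow> (\<forall>g\<in>S. kind F g = Not_Gate)"

definition unary_label :: "('g, 'x) circuit \<Rightarrow> 'g set \<Rightarrow> bool" where
  "unary_label F S \<longleftrightarrow> (\<forall>g\<in>S. is_Input_Gate (kind F g) \<or> kind F g = Not_Gate)"

definition and_label :: "('g, 'x) circuit \<Rightarrow> 'g set \<Rightarrow> bool" where
  "and_label F S \<longleftrightarrow> (\<forall>g\<in>S. kind F g = And_Gate)"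

definition or_label :: "('g, 'x) circuit \<Rightarrow> 'g set \<Rightarrow> bool" where
  "or_label F S \<longleftrightarrow> (\<forall>g\<in>S. kind F g = Or_Gate)"

definition input_free :: "('g, 'x) circuit \<Rightarrow> 'g set \<Rightarrow> bool" where
  "input_free F S \<longleftrightarrow> (\<forall>g\<in>S. \<not> is_Input_Gate (kind F g))"

definition type_respecting :: "('g, 'x) circuit \<Rightarrow> 'g scd \<Rightarrow> bool" where
  "type_respecting F D \<longleftrightarrow>
     (\<forall>S\<in>scd_labels D. \<not> is_singleton S \<longrightarrow> unary_label F S \<or> and_label F S \<or> or_label F S)"


section \<open>The circuit constructed from a circuit and a decomposition\<close>

text \<open>
  For a non-singleton label \<open>S\<close>, the gate \<open>in(S)\<close> is \<open>In_Gate S\<close> if \<open>S\<close> is an AND or OR label, and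
  the chain of the NOT gates \<open>In_Not1 S\<close> and \<open>In_Not2 S\<close> if \<open>S\<close> is unary. Accordingly \<open>in_head\<close> is
  the gate that receives the wires entering \<open>in(S)\<close>, and \<open>in_out\<close> the gate that emits its output.
\<close>

datatype 'g star_gate =
  Orig 'g
| Oand_Gate "'g set"
| Oor_Gate "'g set"
| In_Gate "'g set"
| In_Not1 "'g set"
| In_Not2 "'g set"

definition oand :: "'g set \<Rightarrow> 'g star_gate" where
  "oand S = (if is_singleton S then Orig (the_elem S) else Oand_Gate S)"

definition oor :: "'g set \<Rightarrow> 'g star_gate" where
  "oor S = (if is_singleton S then Orig (the_elem S) else Oor_Gate S)"

definition in_head :: "('g, 'x) circuit \<Rightarrow> 'g set \<Rightarrow> 'g star_gate" where
  "in_head F S =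
     (if is_singleton S then Orig (the_elem S)
      else if unary_label F S then In_Not1 S else In_Gate S)"

definition in_out :: "('g, 'x) circuit \<Rightarrow> 'g set \<Rightarrow> 'g star_gate" where
  "in_out F S =
     (if is_singleton S then Orig (the_elem S)
      else if unary_label F S then In_Not2 S else In_Gate S)"

definition in_gates :: "('g, 'x) circuit \<Rightarrow> 'g scd \<Rightarrow> 'g star_gate set" where
  "in_gates F D =
     (\<Union>S\<in>{S \<in> scd_labels D. \<not> is_singleton S \<and> input_free F S}. {in_head F S, in_out F S})"

definition pre_gates :: "('g, 'x) circuit \<Rightarrow> 'g scd \<Rightarrow> 'g star_gate set" where
  "pre_gates F D =
     {Orig g | g. {g} \<in> scd_labels D} \<union>
     {Oand_Gate S | S. S \<in> scd_labels D \<and> \<not> is_singleton S} \<union>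
     {Oor_Gate S | S. S \<in> scd_labels D \<and> \<not> is_singleton S} \<union>
     in_gates F D"

fun star_kind :: "('g, 'x) circuit \<Rightarrow> 'g star_gate \<Rightarrow> 'x gate_kind" where
  "star_kind F (Orig g) = kind F g"
| "star_kind F (Oand_Gate S) = And_Gate"
| "star_kind F (Oor_Gate S) = Or_Gate"
| "star_kind F (In_Gate S) = (if and_label F S then And_Gate else Or_Gate)"
| "star_kind F (In_Not1 S) = Not_Gate"
| "star_kind F (In_Not2 S) = Not_Gate"

text \<open>
  The argument \<open>ch\<close> resolves the arbitrary choice between \<open>oand S1\<close> and \<open>oor S1\<close> for an arc from \<open>S1\<close>
  to a label \<open>S2\<close> of NOT gates.
\<close>

inductive_set pre_wires ::
    "('g, 'x) circuit \<Rightarrow> 'g scd \<Rightarrow> ('g set \<Rightarrow> 'g set \<Rightarrow> bool) \<Rightarrow> ('g star_gate \<times> 'g star_gate) set"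
  for F :: "('g, 'x) circuit" and D :: "'g scd" and ch :: "'g set \<Rightarrow> 'g set \<Rightarrow> bool" where
  in_chain: "\<lbrakk>S \<in> scd_labels D; \<not> is_singleton S; input_free F S; unary_label F S\<rbrakk>
    \<Longrightarrow> (In_Not1 S, In_Not2 S) \<in> pre_wires F D ch"
| child_parent_and: "label_child D S1 S2 \<Longrightarrow> (oand S1, oand S2) \<in> pre_wires F D ch"
| child_parent_or: "label_child D S1 S2 \<Longrightarrow> (oor S1, oor S2) \<in> pre_wires F D ch"
| parent_child: "\<lbrakk>label_child D S1 S2; input_free F S2\<rbrakk>
    \<Longrightarrow> (in_out F S2, in_head F S1) \<in> pre_wires F D ch"
| adjacency_and: "\<lbrakk>label_arc D S1 S2; and_label F S2\<rbrakk>
    \<Longrightarrow> (oand S1, in_head F S2) \<in> pre_wires F D ch"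
| adjacency_or: "\<lbrakk>label_arc D S1 S2; or_label F S2\<rbrakk>
    \<Longrightarrow> (oor S1, in_head F S2) \<in> pre_wires F D ch"
| adjacency_not: "\<lbrakk>label_arc D S1 S2; not_label F S2\<rbrakk>
    \<Longrightarrow> (if ch S1 S2 then oand S1 else oor S1, in_head F S2) \<in> pre_wires F D ch"

text \<open>
  The gates that are deleted when gates \<open>in(S)\<close> without inputs are removed iteratively: a gate of
  some \<open>in(S)\<close> goes as soon as every gate that feeds it is gone.
\<close>

inductive_set removed_gates ::
    "('g, 'x) circuit \<Rightarrow> 'g scd \<Rightarrow> ('g set \<Rightarrow> 'g set \<Rightarrow> bool) \<Rightarrow> 'g star_gate set"
  for F :: "('g, 'x) circuit" and D :: "'g scd" and ch :: "'g set \<Rightarrow> 'g set \<Rightarrow> bool" where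
  "\<lbrakk>h \<in> in_gates F D; \<forall>h'. (h', h) \<in> pre_wires F D ch \<longrightarrow> h' \<in> removed_gates F D ch\<rbrakk>
    \<Longrightarrow> h \<in> removed_gates F D ch"

definition star_circuit ::
    "('g, 'x) circuit \<Rightarrow> 'g scd \<Rightarrow> ('g set \<Rightarrow> 'g set \<Rightarrow> bool) \<Rightarrow> ('g star_gate, 'x) circuit" where
  "star_circuit F D ch =
     \<lparr>gates = pre_gates F D - removed_gates F D ch,
      kind = star_kind F,
      wires = mset_set {(h, h') \<in> pre_wires F D ch.
                         h \<notin> removed_gates F D ch \<and> h' \<notin> removed_gates F D ch}\<rparr>"

end

theory Submission
  imports Defs "HOL-Library.Product_Lexorder"
begin

text \<open>
  Let the sources of a label \<open>S\<close> be the gates in the labels from which there is an arc to \<open>S\<close> or to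
  an ancestor of \<open>S\<close>; for \<open>S = {g}\<close> these are the gates feeding \<open>g\<close> in \<open>F\<close>. Then \<open>in(S)\<close> survives
  the removal iff \<open>S\<close> has a source, and it computes the conjunction, disjunction or value of the
  sources, while \<open>oand(S)\<close> and \<open>oor(S)\<close> compute the conjunction and disjunction of \<open>S\<close>. The
  assignment of these values satisfies the equations of all gates, which determine the values in an
  acyclic circuit. A cycle is impossible because every path from an original gate to the next one
  follows an arc of \<open>F\<close>.
\<close>

section \<open>Labels of a decomposition\<close>

lemma self_in_nodes [simp]: "D \<in> nodes D"
  by (cases D) auto

lemma scd_labels_simps [simp]:
  "scd_labels (Leaf v) = {{v}}"
  "scd_labels (Join t1 t2) = scd_labels t1 \<union> scd_labels t2"
  "scd_labels (Add_Vertex v t) = insert {v} (scd_labels t)"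
  "scd_labels (Merge S1 S2 t) = insert (S1 \<union> S2) (scd_labels t)"
  "scd_labels (Adjacency S1 S2 t) = scd_labels t"
  using self_in_nodes by (fastforce simp: scd_labels_def)+

lemma label_child_simps [simp]:
  "label_child (Leaf v) S P \<longleftrightarrow> False"
  "label_child (Join t1 t2) S P \<longleftrightarrow> label_child t1 S P \<or> label_child t2 S P"
  "label_child (Add_Vertex v t) S P \<longleftrightarrow> label_child t S P"
  "label_child (Merge S1 S2 t) S P \<longleftrightarrow> label_child t S P \<or> P = S1 \<union> S2 \<and> (S = S1 \<or> S = S2)"
  "label_child (Adjacency S1 S2 t) S P \<longleftrightarrow> label_child t S P"
  unfolding label_child_def by (simp; metis)+

lemma label_arc_simps [simp]:
  "label_arc (Leaf v) S T \<longleftrightarrow> False"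
  "label_arc (Join t1 t2) S T \<longleftrightarrow> label_arc t1 S T \<or> label_arc t2 S T"
  "label_arc (Add_Vertex v t) S T \<longleftrightarrow> label_arc t S T"
  "label_arc (Merge S1 S2 t) S T \<longleftrightarrow> label_arc t S T"
  "label_arc (Adjacency S1 S2 t) S T \<longleftrightarrow> label_arc t S T \<or> S = S1 \<and> T = S2"
  by (auto simp: label_arc_def)

abbreviation label_children :: "'v scd \<Rightarrow> 'v set \<Rightarrow> 'v set set" where
  "label_children D P \<equiv> {S. label_child D S P}"

abbreviation arc_tails :: "'v scd \<Rightarrow> 'v set \<Rightarrow> 'v set set" where
  "arc_tails D T \<equiv> {S. label_arc D S T}"

lemma labels_subset_scd_labels: "labels (graph_at D) \<subseteq> scd_labels D"
  unfolding scd_labels_def using self_in_nodes by blast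

lemma labels_eq_if_Int_nonempty:
  assumes "valid_scd D" "S \<in> labels (graph_at D)" "T \<in> labels (graph_at D)" "S \<inter> T \<noteq> {}"
  shows "S = T"
  using disjointD[OF partition_onD2[OF valid_scd_graph(2)]] assms by metis

lemma scd_label_subset_label:
  assumes "valid_scd D" "S \<in> scd_labels D"
  shows "\<exists>T\<in>labels (graph_at D). S \<subseteq> T"
  using assms
proof (induction D)
  case (Merge S1 S2 t)
  show ?case
  proof (cases "S = S1 \<union> S2")
    case True
    then show ?thesis by simp
  next
    case False
    then obtain T where "T \<in> labels (graph_at t)" "S \<subseteq> T" using Merge by auto
    then show ?thesis by (cases "T = S1 \<or> T = S2") auto
  qed
qed auto

lemma scd_label_subset_verts:
  assumes "valid_scd D" "S \<in> scd_labels D"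
  shows "S \<subseteq> verts (graph_at D)"
  using scd_label_subset_label[OF assms] partition_onD1[OF valid_scd_graph(2)[OF assms(1)]] by blast

lemma scd_label_finite:
  assumes "valid_scd D" "S \<in> scd_labels D"
  shows "finite S"
  using finite_subset[OF scd_label_subset_verts[OF assms] valid_scd_graph(1)[OF assms(1)]] .

lemma scd_label_nonempty: "valid_scd D \<Longrightarrow> S \<in> scd_labels D \<Longrightarrow> S \<noteq> {}"
proof (induction D)
  case (Merge S1 S2 t)
  then have "S1 \<in> scd_labels t" using labels_subset_scd_labels by auto
  with Merge show ?case by auto
qed auto

lemma finite_scd_labels: "valid_scd D \<Longrightarrow> finite (scd_labels D)"
  by (rule finite_subset[of _ "Pow (verts (graph_at D))"])
    (auto dest: scd_label_subset_verts simp: valid_scd_graph(1))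

lemma singleton_scd_label_iff:
  assumes "valid_scd D"
  shows "{g} \<in> scd_labels D \<longleftrightarrow> g \<in> verts (graph_at D)"
proof
  show "{g} \<in> scd_labels D \<Longrightarrow> g \<in> verts (graph_at D)"
    using scd_label_subset_verts[OF assms] by auto
  show "g \<in> verts (graph_at D) \<Longrightarrow> {g} \<in> scd_labels D"
    using assms by (induction D) auto
qed

lemma label_child_scd_labels:
  assumes "valid_scd D" "label_child D S P"
  shows "S \<in> scd_labels D \<and> P \<in> scd_labels D"
  using assms labels_subset_scd_labels by (induction D) auto

lemma label_child_psubset:
  assumes "valid_scd D" "label_child D S P"
  shows "S \<subset> P"
  using assms
proof (induction D)
  case (Merge S1 S2 t)
  then have top: "S1 \<in> labels (graph_at t)" "S2 \<in> labels (graph_at t)" "S1 \<noteq> S2" "valid_scd t"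
    by auto
  then have "S1 \<noteq> {}" "S2 \<noteq> {}"
    using labels_subset_scd_labels scd_label_nonempty by blast+
  moreover have "S1 \<inter> S2 = {}" using labels_eq_if_Int_nonempty top by blast
  ultimately have "S1 \<subset> S1 \<union> S2" "S2 \<subset> S1 \<union> S2" by auto
  then show ?case using Merge by auto
qed auto

lemma label_parent_not_singleton:
  assumes "valid_scd D" "label_child D S P"
  shows "\<not> is_singleton P"
  using label_child_psubset[OF assms] label_child_scd_labels[OF assms]
    scd_label_nonempty[OF assms(1)]
  by (auto simp: is_singleton_def subset_singleton_iff)

lemma Union_label_children:
  assumes "valid_scd D" "P \<in> scd_labels D" "\<not> is_singleton P"
  shows "\<Union>(label_children D P) = P"
proof -
  have "\<exists>S1 S2. label_child D S1 P \<and> label_child D S2 P \<and> P = S1 \<union> S2"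
    using assms
  proof (induction D)
    case (Join t1 t2)
    then show ?case by (auto; blast)
  next
    case (Merge S1 S2 t)
    then show ?case by (auto; blast)
  qed auto
  then show ?thesis using label_child_psubset[OF assms(1)] by blast
qed

lemma label_children_nonempty:
  assumes "valid_scd D" "P \<in> scd_labels D" "\<not> is_singleton P"
  shows "label_children D P \<noteq> {}"
  using Union_label_children[OF assms] scd_label_nonempty[OF assms(1,2)] by blast

lemma top_label_no_parent:
  assumes "valid_scd D" "S \<in> labels (graph_at D)"
  shows "\<not> label_child D S P"
proof
  assume child: "label_child D S P"
  then obtain T where T: "T \<in> labels (graph_at D)" "P \<subseteq> T"
    using label_child_scd_labels scd_label_subset_label assms(1) by blast
  have "S \<subset> T" using label_child_psubset[OF assms(1) child] T(2) by blast
  moreover have "S \<noteq> {}" using child assms(1) label_child_scd_labels scd_label_nonempty by blast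
  ultimately show False using labels_eq_if_Int_nonempty[OF assms T(1)] by blast
qed

lemma scd_labels_Int_empty:
  assumes "valid_scd t1" "valid_scd t2" "verts (graph_at t1) \<inter> verts (graph_at t2) = {}"
    and "S \<in> scd_labels t1" "T \<in> scd_labels t2"
  shows "S \<inter> T = {}"
  using scd_label_subset_verts[OF assms(1,4)] scd_label_subset_verts[OF assms(2,5)] assms(3)
  by blast

lemma label_parent_unique:
  assumes "valid_scd D" "label_child D S P" "label_child D S Q"
  shows "P = Q"
  using assms
proof (induction D)
  case (Join t1 t2)
  have "\<not> (S \<in> scd_labels t1 \<and> S \<in> scd_labels t2)"
    using scd_labels_Int_empty[of t1 t2 S S] scd_label_nonempty[of t1 S] Join.prems(1) by auto
  then show ?case using Join label_child_scd_labels[of t1 S] label_child_scd_labels[of t2 S] by auto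
next
  case (Merge S1 S2 t)
  then have "\<not> label_child t S1 R" "\<not> label_child t S2 R" for R
    using top_label_no_parent by auto
  then show ?case using Merge by auto
qed auto

lemma scd_label_parent_induct [consumes 2, case_names label]:
  assumes "valid_scd D" "S \<in> scd_labels D"
    and step: "\<And>S. S \<in> scd_labels D \<Longrightarrow> (\<And>P. label_child D S P \<Longrightarrow> Q P) \<Longrightarrow> Q S"
  shows "Q S"
  using assms(2)
proof (induction "verts (graph_at D) - S" arbitrary: S rule: measure_induct_rule[of card])
  case (less S)
  show ?case
  proof (rule step[OF less.prems])
    fix P assume child: "label_child D S P"
    have P: "P \<in> scd_labels D" using label_child_scd_labels[OF assms(1) child] by blast
    have "verts (graph_at D) - P \<subset> verts (graph_at D) - S"
      using label_child_psubset[OF assms(1) child] scd_label_subset_verts[OF assms(1) P] by blast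
    then have "card (verts (graph_at D) - P) < card (verts (graph_at D) - S)"
      using psubset_card_mono valid_scd_graph(1)[OF assms(1)] by blast
    then show "Q P" using less.hyps P by blast
  qed
qed

definition label_descendant :: "'v scd \<Rightarrow> 'v set \<Rightarrow> 'v set \<Rightarrow> bool" where
  "label_descendant D = (label_child D)\<^sup>*\<^sup>*"

lemma label_descendant_iff:
  "label_descendant D S T \<longleftrightarrow> S = T \<or> (\<exists>P. label_child D S P \<and> label_descendant D P T)"
  unfolding label_descendant_def
  by (metis converse_rtranclpE converse_rtranclp_into_rtranclp rtranclp.rtrancl_refl)

lemma label_descendant_subset:
  assumes "valid_scd D" "label_descendant D S T"
  shows "S \<subseteq> T"
  using assms(2) unfolding label_descendant_def
  by (induction rule: rtranclp_induct) (use label_child_psubset[OF assms(1)] in blast)+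

lemma singleton_label_descendant:
  assumes "valid_scd D" "T \<in> scd_labels D" "v \<in> T"
  shows "label_descendant D {v} T"
  using scd_label_finite[OF assms(1,2)] assms(2,3)
proof (induction T rule: finite_psubset_induct)
  case (psubset T)
  show ?case
  proof (cases "is_singleton T")
    case True
    then show ?thesis using psubset.prems by (auto simp: is_singleton_def label_descendant_def)
  next
    case False
    then obtain S where S: "label_child D S T" "v \<in> S"
      using Union_label_children[OF assms(1) psubset.prems(1)] psubset.prems(2) by blast
    then have "label_descendant D {v} S"
      using psubset.IH[of S] label_child_psubset[OF assms(1) S(1)]
        label_child_scd_labels[OF assms(1) S(1)] by simp
    then show ?thesis
      using S(1) unfolding label_descendant_def by (rule rtranclp.rtrancl_into_rtrancl)
  qed
qed

lemma label_arc_scd_labels: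
  assumes "valid_scd D" "label_arc D S T"
  shows "S \<in> scd_labels D \<and> T \<in> scd_labels D"
  using assms labels_subset_scd_labels by (induction D) auto

lemma finite_Times_labels:
  assumes "valid_scd D" "S \<in> labels (graph_at D)" "T \<in> labels (graph_at D)"
  shows "finite (S \<times> T)"
  using assms labels_subset_scd_labels scd_label_finite by blast

lemma in_arcs_iff_label_arc:
  assumes "valid_scd D"
  shows "(u, v) \<in># arcs (graph_at D) \<longleftrightarrow> (\<exists>S T. label_arc D S T \<and> u \<in> S \<and> v \<in> T)"
  using assms
proof (induction D)
  case (Join t1 t2)
  then show ?case by (simp; blast)
next
  case (Adjacency S1 S2 t)
  then show ?case using finite_Times_labels[of t S1 S2] by (simp; blast)
qed auto

lemma count_arcs_ge_two:
  assumes "valid_scd D" "label_arc D S T" "label_arc D S' T'" "(S, T) \<noteq> (S', T')"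
    and "u \<in> S \<inter> S'" "v \<in> T \<inter> T'"
  shows "count (arcs (graph_at D)) (u, v) \<ge> 2"
  using assms
proof (induction D)
  case (Join t1 t2)
  have valid: "valid_scd t1" "valid_scd t2" using Join.prems by auto
  have "B \<inter> B' = {}" if "label_arc t1 A B" "label_arc t2 A' B'" for A B A' B'
    using scd_labels_Int_empty[OF valid] label_arc_scd_labels valid that Join.prems(1)
    by (meson valid_scd.simps(2))
  from this[of S T S' T'] this[of S' T' S T] Join.prems
  consider "label_arc t1 S T" "label_arc t1 S' T'" | "label_arc t2 S T" "label_arc t2 S' T'" by auto
  then show ?case using Join.IH Join.prems valid by cases auto
next
  case (Adjacency S1 S2 t)
  have valid: "valid_scd t" using Adjacency.prems by simp
  show ?case
  proof (cases "label_arc t S T \<and> label_arc t S' T'")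
    case True
    then show ?thesis using Adjacency valid by auto
  next
    case False
    then have "(S, T) = (S1, S2) \<or> (S', T') = (S1, S2)" "label_arc t S T \<or> label_arc t S' T'"
      using Adjacency.prems by auto
    then have "(u, v) \<in> S1 \<times> S2" "(u, v) \<in># arcs (graph_at t)"
      using Adjacency.prems in_arcs_iff_label_arc[OF valid] by auto
    then show ?thesis
      using finite_Times_labels[of t S1 S2] Adjacency.prems(1)
      by (simp add: count_mset_set flip: count_greater_zero_iff)
  qed
qed auto

definition label_sources :: "'v scd \<Rightarrow> 'v set \<Rightarrow> 'v set" where
  "label_sources D S = \<Union>{S1. \<exists>T. label_descendant D S T \<and> label_arc D S1 T}"

lemma label_sources_rec:
  "label_sources D S =
    \<Union>(arc_tails D S) \<union> (\<Union>P\<in>{P. label_child D S P}. label_sources D P)"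
  unfolding label_sources_def by (subst label_descendant_iff) blast

abbreviation fed_parents :: "'v scd \<Rightarrow> 'v set \<Rightarrow> 'v set set" where
  "fed_parents D S \<equiv> {P. label_child D S P \<and> label_sources D P \<noteq> {}}"

lemma label_sources_eq_Union_fed:
  "label_sources D S = \<Union>(label_sources D ` fed_parents D S \<union> arc_tails D S)"
  unfolding label_sources_rec[of D S] by blast

lemma label_sources_empty_iff:
  assumes "valid_scd D"
  shows "label_sources D S = {} \<longleftrightarrow>
    (\<forall>S1. \<not> label_arc D S1 S) \<and> (\<forall>P. label_child D S P \<longrightarrow> label_sources D P = {})"
proof -
  have "S1 \<noteq> {}" if "label_arc D S1 S" for S1
    using label_arc_scd_labels[OF assms that] scd_label_nonempty[OF assms] by blast
  then show ?thesis unfolding label_sources_rec[of D S] by auto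
qed

lemma label_sources_singleton:
  assumes "valid_scd D"
  shows "label_sources D {v} = {u. (u, v) \<in># arcs (graph_at D)}"
proof -
  have "label_descendant D {v} T \<longleftrightarrow> v \<in> T" if "label_arc D S T" for S T
    using label_descendant_subset[OF assms] singleton_label_descendant[OF assms]
      label_arc_scd_labels[OF assms that] by blast
  then show ?thesis unfolding label_sources_def in_arcs_iff_label_arc[OF assms] by blast
qed


section \<open>Circuits\<close>

lemma finite_acyclic_rank:
  assumes "finite R" "acyclic R"
  obtains r :: "'a \<Rightarrow> nat" where "\<And>x y. (x, y) \<in> R \<Longrightarrow> r x < r y"
proof
  fix x y assume xy: "(x, y) \<in> R"
  have fin: "finite {z. (z, y) \<in> R\<^sup>+}"
    by (rule finite_subset[of _ "Domain R"])
      (use assms(1) in \<open>auto simp: finite_Domain dest: tranclD\<close>)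
  have "x \<notin> {z. (z, x) \<in> R\<^sup>+}" using assms(2) by (auto simp: acyclic_def)
  moreover have "x \<in> {z. (z, y) \<in> R\<^sup>+}" using xy by auto
  moreover have "{z. (z, x) \<in> R\<^sup>+} \<subseteq> {z. (z, y) \<in> R\<^sup>+}" using xy by (auto intro: trancl_into_trancl)
  ultimately have "{z. (z, x) \<in> R\<^sup>+} \<subset> {z. (z, y) \<in> R\<^sup>+}" by blast
  then show "card {z. (z, x) \<in> R\<^sup>+} < card {z. (z, y) \<in> R\<^sup>+}" by (rule psubset_card_mono[OF fin])
qed

definition in_neighbours :: "('g, 'x) circuit \<Rightarrow> 'g \<Rightarrow> 'g set" where
  "in_neighbours C g = {h. (h, g) \<in># wires C}"

lemma fan_in_pos_iff: "fan_in C g > 0 \<longleftrightarrow> in_neighbours C g \<noteq> {}"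
proof -
  have "fan_in C g > 0 \<longleftrightarrow> {#e \<in># wires C. snd e = g#} \<noteq> {#}"
    unfolding fan_in_def by (rule nonempty_has_size[symmetric])
  also have "\<dots> \<longleftrightarrow> in_neighbours C g \<noteq> {}"
    by (auto simp: in_neighbours_def)
  finally show ?thesis .
qed

lemma is_singleton_in_neighbours:
  assumes "fan_in C g = 1"
  shows "is_singleton (in_neighbours C g)"
  using fan_in_one_ex1[OF assms] unfolding in_neighbours_def is_singleton_def by blast

lemma count_wires_le_fan_in: "count (wires C) (h, g) \<le> fan_in C g"
proof -
  have "count (wires C) (h, g) = count {#e \<in># wires C. snd e = g#} (h, g)" by simp
  also have "\<dots> \<le> fan_in C g" unfolding fan_in_def by (rule count_le_size)
  finally show ?thesis .
qed

lemma fan_in_mset_set: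
  assumes "wires C = mset_set W" "finite W"
  shows "fan_in C g = card (in_neighbours C g)"
proof -
  have "fan_in C g = card {e \<in> W. snd e = g}"
    unfolding fan_in_def assms(1) by (simp add: filter_mset_mset_set assms(2))
  also have "{e \<in> W. snd e = g} = (\<lambda>h. (h, g)) ` in_neighbours C g"
    using assms by (auto simp: in_neighbours_def)
  also have "card \<dots> = card (in_neighbours C g)" by (rule card_image) (simp add: inj_on_def)
  finally show ?thesis .
qed

text \<open>
  For a NOT gate, which has a single input, the conjunction of the input values is just the value of
  that input. With this convention, the three types of labels can be treated alike.
\<close>

definition junction :: "'x gate_kind \<Rightarrow> bool set \<Rightarrow> bool" where
  "junction k B \<longleftrightarrow> (if k = Or_Gate then True \<in> B else False \<notin> B)"

lemma junction_singleton [simp]: "junction k {b} \<longleftrightarrow> b"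
  by (auto simp: junction_def)

lemma junction_image_junction:
  "junction k ((\<lambda>X. junction k (v ` X)) ` \<X>) \<longleftrightarrow> junction k (v ` \<Union>\<X>)"
  by (auto simp: junction_def)

definition gate_op :: "('x \<Rightarrow> bool) \<Rightarrow> 'x gate_kind \<Rightarrow> bool set \<Rightarrow> bool" where
  "gate_op \<alpha> k B \<longleftrightarrow>
     (case k of Input_Gate x \<Rightarrow> \<alpha> x | Not_Gate \<Rightarrow> \<not> junction k B | _ \<Rightarrow> junction k B)"

lemma gate_op_cong: "junction k B = junction k B' \<Longrightarrow> gate_op \<alpha> k B = gate_op \<alpha> k B'"
  by (cases k) (simp_all add: gate_op_def)

lemma gate_step_eq_gate_op:
  assumes "fan_in_ok (kind C g) (fan_in C g)"
  shows "gate_step C \<alpha> val g = gate_op \<alpha> (kind C g) (val ` in_neighbours C g)"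
proof (cases "kind C g")
  case Not_Gate
  then obtain h where "in_neighbours C g = {h}"
    using assms is_singleton_in_neighbours[of C g] by (auto simp: is_singleton_def)
  moreover from this have "(THE h. (h, g) \<in># wires C) = h" by (auto simp: in_neighbours_def)
  ultimately show ?thesis using Not_Gate by (simp add: gate_step_def gate_op_def)
qed (auto simp: gate_step_def gate_op_def junction_def in_neighbours_def)

lemma gate_value_eq_gate_op:
  assumes "well_formed_circuit C" "g \<in> gates C"
  shows "gate_value C \<alpha> g = gate_op \<alpha> (kind C g) (gate_value C \<alpha> ` in_neighbours C g)"
  unfolding gate_value_unfold[OF assms]
  by (rule gate_step_eq_gate_op) (use assms in \<open>simp add: well_formed_circuit_def\<close>)

lemma gate_value_unique:
  assumes C: "well_formed_circuit C"
    and val: "\<And>g. g \<in> gates C \<Longrightarrow> val g = gate_op \<alpha> (kind C g) (val ` in_neighbours C g)"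
    and "g \<in> gates C"
  shows "gate_value C \<alpha> g = val g"
proof -
  have "wf (set_mset (wires C))"
    using C by (simp add: well_formed_circuit_def finite_acyclic_wf)
  then show ?thesis using \<open>g \<in> gates C\<close>
  proof (induction g rule: wf_induct_rule)
    case (less g)
    have "gate_value C \<alpha> h = val h" if "h \<in> in_neighbours C g" for h
      using less.IH[of h] that C by (auto simp: well_formed_circuit_def in_neighbours_def)
    then have "gate_value C \<alpha> ` in_neighbours C g = val ` in_neighbours C g" by simp
    then show ?case using gate_value_eq_gate_op[OF C less.prems] val[OF less.prems] by simp
  qed
qed


section \<open>Labels of a single kind\<close>

definition has_kind :: "('g, 'x) circuit \<Rightarrow> 'g set \<Rightarrow> 'x gate_kind \<Rightarrow> bool" where
  "has_kind F S k \<longleftrightarrow> kind F ` S = {k}"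

lemma has_kind_singleton [simp]: "has_kind F {g} k \<longleftrightarrow> kind F g = k"
  by (auto simp: has_kind_def)

lemma has_kind_iff: "has_kind F S k \<longleftrightarrow> S \<noteq> {} \<and> (\<forall>g\<in>S. kind F g = k)"
  by (auto simp: has_kind_def)

lemma has_kind_unique: "has_kind F S k \<Longrightarrow> has_kind F S k' \<Longrightarrow> k = k'"
  by (simp add: has_kind_def)

lemma has_kind_subset: "has_kind F P k \<Longrightarrow> S \<subseteq> P \<Longrightarrow> S \<noteq> {} \<Longrightarrow> has_kind F S k"
  by (auto simp: has_kind_iff)

lemma label_type_iff_kind:
  assumes "has_kind F S k"
  shows "and_label F S \<longleftrightarrow> k = And_Gate"
    and "or_label F S \<longleftrightarrow> k = Or_Gate"
    and "not_label F S \<longleftrightarrow> k = Not_Gate"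
    and "unary_label F S \<longleftrightarrow> is_Input_Gate k \<or> k = Not_Gate"
    and "input_free F S \<longleftrightarrow> \<not> is_Input_Gate k"
  using assms
  by (auto simp: has_kind_iff and_label_def or_label_def not_label_def unary_label_def
      input_free_def)

lemma input_free_has_kind:
  assumes "valid_scd D" "type_respecting F D" "S \<in> scd_labels D" "input_free F S"
  obtains k where "has_kind F S k" "\<not> is_Input_Gate k"
proof -
  have nonempty: "S \<noteq> {}" by (rule scd_label_nonempty[OF assms(1,3)])
  obtain k where "has_kind F S k"
  proof (cases "is_singleton S")
    case True
    then show ?thesis using that has_kind_singleton by (metis is_singleton_def)
  next
    case False
    then consider (unary) "unary_label F S" | "and_label F S" | "or_label F S"
      using assms(2,3) by (auto simp: type_respecting_def)
    then show ?thesis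
    proof cases
      case unary
      then have "has_kind F S Not_Gate"
        using nonempty assms(4) by (auto simp: has_kind_iff unary_label_def input_free_def)
      then show ?thesis by (rule that)
    qed (use nonempty that in \<open>auto simp: has_kind_iff and_label_def or_label_def\<close>)
  qed
  then show ?thesis using that label_type_iff_kind(5) assms(4) by blast
qed


section \<open>Gates and wires of the constructed circuit\<close>

lemma in_head_eq_iff [simp]: "in_head F S = in_head F T \<longleftrightarrow> S = T"
  by (auto simp: in_head_def is_singleton_def split: if_splits)

lemma star_kind_in_head:
  assumes "has_kind F S k" "\<not> is_Input_Gate k"
  shows "star_kind F (in_head F S) = k"
  using assms(2) label_type_iff_kind[OF assms(1)] assms(1)
  by (cases k) (auto simp: in_head_def is_singleton_def)

definition arc_gate ::
    "('g, 'x) circuit \<Rightarrow> ('g set \<Rightarrow> 'g set \<Rightarrow> bool) \<Rightarrow> 'g set \<Rightarrow> 'g set \<Rightarrow> 'g star_gate" where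
  "arc_gate F ch S T =
     (if and_label F T \<or> \<not> or_label F T \<and> ch S T then oand S else oor S)"

lemma not_in_gates [simp]:
  "Orig g \<notin> in_gates F D" "Oand_Gate S \<notin> in_gates F D" "Oor_Gate S \<notin> in_gates F D"
  "oand S \<notin> in_gates F D" "oor S \<notin> in_gates F D" "arc_gate F ch S T \<notin> in_gates F D"
  by (auto simp: in_gates_def in_head_def in_out_def arc_gate_def oand_def oor_def split: if_splits)

lemma removed_gate_in_gates: "h \<in> removed_gates F D ch \<Longrightarrow> h \<in> in_gates F D"
  by (erule removed_gates.cases) simp

lemma not_removed_gates [simp]:
  "Orig g \<notin> removed_gates F D ch" "Oand_Gate S \<notin> removed_gates F D ch"
  "Oor_Gate S \<notin> removed_gates F D ch" "oand S \<notin> removed_gates F D ch"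
  "oor S \<notin> removed_gates F D ch" "arc_gate F ch' S T \<notin> removed_gates F D ch"
  by (auto dest!: removed_gate_in_gates)

lemma removed_gates_iff:
  "h \<in> removed_gates F D ch \<longleftrightarrow>
     h \<in> in_gates F D \<and> {h'. (h', h) \<in> pre_wires F D ch} \<subseteq> removed_gates F D ch"
  by (subst removed_gates.simps) blast

locale decomposed_circuit =
  fixes F :: "('g, 'x) circuit" and D :: "'g scd" and ch :: "'g set \<Rightarrow> 'g set \<Rightarrow> bool"
  assumes wf_F: "well_formed_circuit F"
    and scd_F: "scd_of D F"
    and typed: "type_respecting F D"
begin

abbreviation "star \<equiv> star_circuit F D ch"

abbreviation "removed \<equiv> removed_gates F D ch"

abbreviation "pre_inputs h \<equiv> {h'. (h', h) \<in> pre_wires F D ch}"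

lemma valid: "valid_scd D"
  using scd_F by (simp add: scd_of_def)

lemma finite_gates: "finite (gates F)"
  using wf_F by (simp add: well_formed_circuit_def)

lemma fan_in_ok_F: "g \<in> gates F \<Longrightarrow> fan_in_ok (kind F g) (fan_in F g)"
  using wf_F by (simp add: well_formed_circuit_def)

lemma label_subset_gates: "S \<in> scd_labels D \<Longrightarrow> S \<subseteq> gates F"
  using scd_label_subset_verts[OF valid] scd_F by (simp add: scd_of_def)

lemma singleton_label_iff: "{g} \<in> scd_labels D \<longleftrightarrow> g \<in> gates F"
  using singleton_scd_label_iff[OF valid] scd_F by (simp add: scd_of_def)

lemma wire_iff_label_arc: "(h, g) \<in># wires F \<longleftrightarrow> (\<exists>S T. label_arc D S T \<and> h \<in> S \<and> g \<in> T)"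
  using in_arcs_iff_label_arc[OF valid] scd_F by (simp add: scd_of_def)

lemma label_sources_singleton_in_neighbours: "label_sources D {g} = in_neighbours F g"
  using label_sources_singleton[OF valid] scd_F by (simp add: scd_of_def in_neighbours_def)

lemmas label_finite = scd_label_finite[OF valid]
  and label_nonempty = scd_label_nonempty[OF valid]
  and child_labels = label_child_scd_labels[OF valid]
  and child_psubset = label_child_psubset[OF valid]
  and parent_not_singleton = label_parent_not_singleton[OF valid]
  and arc_labels = label_arc_scd_labels[OF valid]

lemma arc_target_nonempty: "label_arc D S T \<Longrightarrow> T \<noteq> {}"
  using arc_labels label_nonempty by blast

lemma arc_target_input_free:
  assumes "label_arc D S T"
  shows "input_free F T"
  unfolding input_free_def
proof (intro ballI notI)
  fix g assume g: "g \<in> T" "is_Input_Gate (kind F g)"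
  obtain h where "h \<in> S" using label_nonempty arc_labels[OF assms] by blast
  then have "h \<in> in_neighbours F g"
    using g assms by (auto simp: in_neighbours_def wire_iff_label_arc)
  then have "fan_in F g > 0" unfolding fan_in_pos_iff by blast
  moreover have "g \<in> gates F" using g label_subset_gates arc_labels[OF assms] by blast
  ultimately show False using fan_in_ok_F[of g] g(2) by (cases "kind F g") auto
qed

lemma label_sources_input_free:
  assumes "label_sources D S \<noteq> {}"
  shows "input_free F S"
proof -
  obtain S1 T where "label_descendant D S T" "label_arc D S1 T"
    using assms by (auto simp: label_sources_def)
  then have "S \<subseteq> T" "input_free F T"
    using label_descendant_subset[OF valid] arc_target_input_free by auto
  then show ?thesis by (auto simp: input_free_def)
qed

lemma arc_target_has_kind:
  assumes "label_arc D S T"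
  obtains k where "has_kind F T k" "\<not> is_Input_Gate k"
  using input_free_has_kind[OF valid typed _ arc_target_input_free[OF assms]] arc_labels[OF assms]
  by blast

lemma child_has_kind:
  assumes "label_child D S P" "has_kind F P k"
  shows "has_kind F S k"
  using has_kind_subset[OF assms(2)] child_psubset[OF assms(1)] child_labels[OF assms(1)]
    label_nonempty by blast

lemma parent_has_kind:
  assumes "label_child D S P" "input_free F P" "has_kind F S k"
  shows "has_kind F P k"
proof -
  obtain k' where k': "has_kind F P k'"
    using input_free_has_kind[OF valid typed _ assms(2)] child_labels[OF assms(1)] by blast
  then have "k' = k" using has_kind_unique child_has_kind[OF assms(1)] assms(3) by blast
  with k' show ?thesis by simp
qed

lemma pre_wires_into_out_gates:
  shows "pre_inputs (Oand_Gate S) = oand ` label_children D S"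
    and "pre_inputs (Oor_Gate S) = oor ` label_children D S"
proof -
  have child_wires: "(oand S', Oand_Gate S) \<in> pre_wires F D ch"
    "(oor S', Oor_Gate S) \<in> pre_wires F D ch"
    if "label_child D S' S" for S'
    using pre_wires.child_parent_and[OF that] pre_wires.child_parent_or[OF that]
      parent_not_singleton[OF that] by (simp_all add: oand_def[of S] oor_def[of S])
  have "pre_inputs (Oand_Gate S) \<subseteq> oand ` label_children D S"
    "pre_inputs (Oor_Gate S) \<subseteq> oor ` label_children D S"
    by (auto elim!: pre_wires.cases simp: oand_def oor_def in_head_def split: if_splits)
  then show "pre_inputs (Oand_Gate S) = oand ` label_children D S"
    and "pre_inputs (Oor_Gate S) = oor ` label_children D S"
    using child_wires by auto
qed

lemma pre_wires_into_In_Not2: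
  assumes "S \<in> scd_labels D" "\<not> is_singleton S" "input_free F S" "unary_label F S"
  shows "pre_inputs (In_Not2 S) = {In_Not1 S}"
  using pre_wires.in_chain[OF assms]
  by (auto elim!: pre_wires.cases simp: oand_def oor_def in_head_def split: if_splits)

lemma arc_gate_eq:
  assumes "label_arc D S T"
  shows "and_label F T \<Longrightarrow> arc_gate F ch S T = oand S"
    and "or_label F T \<Longrightarrow> arc_gate F ch S T = oor S"
    and "not_label F T \<Longrightarrow> arc_gate F ch S T = (if ch S T then oand S else oor S)"
  using arc_target_nonempty[OF assms]
  by (auto simp: arc_gate_def and_label_def or_label_def not_label_def)

lemma arc_gate_pre_wire:
  assumes "label_arc D S T"
  shows "(arc_gate F ch S T, in_head F T) \<in> pre_wires F D ch"
proof -
  obtain k where k: "has_kind F T k" "\<not> is_Input_Gate k" by (rule arc_target_has_kind[OF assms])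
  then consider (and_label) "and_label F T" | (or_label) "or_label F T"
    | (not_label) "not_label F T"
    using label_type_iff_kind[OF k(1)] by (cases k) auto
  then show ?thesis
  proof cases
    case and_label
    then show ?thesis using pre_wires.adjacency_and[OF assms] arc_gate_eq(1)[OF assms] by simp
  next
    case or_label
    then show ?thesis using pre_wires.adjacency_or[OF assms] arc_gate_eq(2)[OF assms] by simp
  next
    case not_label
    then show ?thesis
      using pre_wires.adjacency_not[OF assms, of F ch] arc_gate_eq(3)[OF assms] by simp
  qed
qed

lemma pre_wires_into_in_head:
  "pre_inputs (in_head F S) =
     in_out F ` {P. label_child D S P \<and> input_free F P} \<union>
     (\<lambda>S1. arc_gate F ch S1 S) ` arc_tails D S" (is "?L = ?R")
proof
  show "?L \<subseteq> ?R"
  proof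
    fix h assume "h \<in> ?L"
    then have "(h, in_head F S) \<in> pre_wires F D ch" by simp
    then show "h \<in> ?R"
    proof cases
      case (in_chain S')
      then show ?thesis by (auto simp: in_head_def split: if_splits)
    next
      case (child_parent_and S1 S2)
      then show ?thesis
        using parent_not_singleton by (auto simp: in_head_def oand_def[of S2] split: if_splits)
    next
      case (child_parent_or S1 S2)
      then show ?thesis
        using parent_not_singleton by (auto simp: in_head_def oor_def[of S2] split: if_splits)
    next
      case (parent_child S1 S2)
      then show ?thesis by auto
    next
      case (adjacency_and S1 S2)
      then have "h = arc_gate F ch S1 S" "label_arc D S1 S" using arc_gate_eq(1) by auto
      then show ?thesis by blast
    next
      case (adjacency_or S1 S2)
      then have "h = arc_gate F ch S1 S" "label_arc D S1 S" using arc_gate_eq(2) by auto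
      then show ?thesis by blast
    next
      case (adjacency_not S1 S2)
      then have "h = arc_gate F ch S1 S" "label_arc D S1 S" using arc_gate_eq(3) by auto
      then show ?thesis by blast
    qed
  qed
  show "?R \<subseteq> ?L" using pre_wires.parent_child arc_gate_pre_wire by fastforce
qed


section \<open>Removed gates and remaining wires\<close>

lemma in_out_removed_iff:
  assumes "S \<in> scd_labels D" "\<not> is_singleton S" "input_free F S"
  shows "in_out F S \<in> removed \<longleftrightarrow> in_head F S \<in> removed"
proof (cases "unary_label F S")
  case True
  then have "in_head F S = In_Not1 S" "in_out F S = In_Not2 S"
    using assms(2) by (simp_all add: in_head_def in_out_def)
  moreover from this have "In_Not2 S \<in> in_gates F D" using assms by (force simp: in_gates_def)
  ultimately show ?thesis
    using removed_gates_iff[of "In_Not2 S" F D ch] pre_wires_into_In_Not2[OF assms True] by simp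
next
  case False
  then show ?thesis using assms(2) by (simp add: in_head_def in_out_def)
qed

text \<open>A parent that is not input-free has no sources, hence the missing wire does not matter.\<close>

lemma in_head_removed_iff:
  assumes "S \<in> scd_labels D" "\<not> is_singleton S" "input_free F S"
  shows "in_head F S \<in> removed \<longleftrightarrow> label_sources D S = {}"
  using valid assms
proof (induction S rule: scd_label_parent_induct)
  case (label S)
  have parent: "in_out F P \<in> removed \<longleftrightarrow> label_sources D P = {}"
    if "label_child D S P" "input_free F P" for P
    using label.IH[OF that(1)] in_out_removed_iff child_labels[OF that(1)]
      parent_not_singleton[OF that(1)] that(2) by blast
  have "in_head F S \<in> in_gates F D"
    using label.hyps label.prems by (auto simp: in_gates_def)
  then have "in_head F S \<in> removed \<longleftrightarrow>
      (\<forall>P. label_child D S P \<and> input_free F P \<longrightarrow> in_out F P \<in> removed) \<and>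
      (\<forall>S1. \<not> label_arc D S1 S)"
    by (subst removed_gates_iff) (auto simp: pre_wires_into_in_head)
  also have "\<dots> \<longleftrightarrow> label_sources D S = {}"
    using parent label_sources_input_free unfolding label_sources_empty_iff[OF valid, of S] by blast
  finally show ?case .
qed

lemma in_head_not_removed:
  assumes "S \<in> scd_labels D" "label_sources D S \<noteq> {}"
  shows "in_head F S \<notin> removed"
proof (cases "is_singleton S")
  case True
  then show ?thesis by (simp add: in_head_def)
next
  case False
  then show ?thesis using in_head_removed_iff label_sources_input_free assms by blast
qed

lemma out_gates_in_pre_gates:
  assumes "S \<in> scd_labels D"
  shows "oand S \<in> pre_gates F D" "oor S \<in> pre_gates F D"
  using assms by (auto simp: oand_def oor_def pre_gates_def is_singleton_def)

lemma in_gates_in_pre_gates: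
  assumes "S \<in> scd_labels D" "input_free F S"
  shows "in_head F S \<in> pre_gates F D" "in_out F S \<in> pre_gates F D"
proof -
  have "in_head F S \<in> pre_gates F D \<and> in_out F S \<in> pre_gates F D"
  proof (cases "is_singleton S")
    case True
    then show ?thesis
      using assms by (auto simp: in_head_def in_out_def pre_gates_def is_singleton_def)
  next
    case False
    then show ?thesis using assms by (auto simp: pre_gates_def in_gates_def)
  qed
  then show "in_head F S \<in> pre_gates F D" "in_out F S \<in> pre_gates F D" by auto
qed

lemma pre_wires_subset: "pre_wires F D ch \<subseteq> pre_gates F D \<times> pre_gates F D"
proof (rule subrelI)
  fix h h' assume "(h, h') \<in> pre_wires F D ch"
  then show "(h, h') \<in> pre_gates F D \<times> pre_gates F D"
  proof cases
    case (in_chain S)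
    then show ?thesis using in_gates_in_pre_gates[of S] by (simp add: in_head_def in_out_def)
  next
    case (parent_child S1 S2)
    then have "input_free F S1" using child_psubset[of S1 S2] by (auto simp: input_free_def)
    then show ?thesis using parent_child child_labels in_gates_in_pre_gates by auto
  qed (auto dest: child_labels arc_labels arc_target_input_free
      intro: out_gates_in_pre_gates in_gates_in_pre_gates)
qed

lemma finite_pre_gates: "finite (pre_gates F D)"
proof -
  have fin: "finite (scd_labels D)" by (rule finite_scd_labels[OF valid])
  have "{Orig g |g. {g} \<in> scd_labels D} = Orig ` gates F" by (auto simp: singleton_label_iff)
  moreover have "finite {Oand_Gate S |S. S \<in> scd_labels D \<and> \<not> is_singleton S}"
    "finite {Oor_Gate S |S. S \<in> scd_labels D \<and> \<not> is_singleton S}"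
    using fin by simp_all
  moreover have "finite (in_gates F D)" using fin by (simp add: in_gates_def)
  ultimately show ?thesis using finite_gates by (simp add: pre_gates_def)
qed

lemma gates_star: "gates star = pre_gates F D - removed"
  by (simp add: star_circuit_def)

lemma kind_star: "kind star = star_kind F"
  by (simp add: star_circuit_def)

definition star_wires :: "('g star_gate \<times> 'g star_gate) set" where
  "star_wires = {(h, h') \<in> pre_wires F D ch. h \<notin> removed \<and> h' \<notin> removed}"

lemma wires_star: "wires star = mset_set star_wires"
  by (simp add: star_circuit_def star_wires_def)

lemma finite_star_wires: "finite star_wires"
  by (rule finite_subset[of _ "pre_gates F D \<times> pre_gates F D"])
    (use pre_wires_subset finite_pre_gates in \<open>auto simp: star_wires_def\<close>)

lemma set_wires_star: "set_mset (wires star) = star_wires"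
  by (simp add: wires_star finite_star_wires)

lemma fan_in_star: "fan_in star h = card (in_neighbours star h)"
  by (rule fan_in_mset_set[OF wires_star finite_star_wires])

lemma in_neighbours_star:
  assumes "h \<notin> removed"
  shows "in_neighbours star h = pre_inputs h - removed"
  using assms unfolding in_neighbours_def set_wires_star by (auto simp: star_wires_def)

lemma in_neighbours_out_gates:
  "in_neighbours star (Oand_Gate S) = oand ` label_children D S"
  "in_neighbours star (Oor_Gate S) = oor ` label_children D S"
  by (auto simp: in_neighbours_star pre_wires_into_out_gates)

lemma in_neighbours_In_Not2:
  assumes "S \<in> scd_labels D" "\<not> is_singleton S" "unary_label F S" "label_sources D S \<noteq> {}"
  shows "in_neighbours star (In_Not2 S) = {In_Not1 S}"
proof -
  have free: "input_free F S" using label_sources_input_free assms(4) by blast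
  have "in_head F S = In_Not1 S" "in_out F S = In_Not2 S"
    using assms(2,3) by (simp_all add: in_head_def in_out_def)
  then have "In_Not1 S \<notin> removed" "In_Not2 S \<notin> removed"
    using in_head_not_removed[OF assms(1,4)] in_out_removed_iff[OF assms(1,2) free] by simp_all
  then show ?thesis
    using in_neighbours_star[of "In_Not2 S"] pre_wires_into_In_Not2[OF assms(1,2) free assms(3)]
    by auto
qed

lemma in_neighbours_in_head:
  assumes "S \<in> scd_labels D" "label_sources D S \<noteq> {}"
  shows "in_neighbours star (in_head F S) =
    in_out F ` fed_parents D S \<union>
    (\<lambda>S1. arc_gate F ch S1 S) ` arc_tails D S"
proof -
  have "input_free F P \<and> in_out F P \<notin> removed \<longleftrightarrow> label_sources D P \<noteq> {}"
    if "label_child D S P" for P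
    using in_out_removed_iff[of P] in_head_removed_iff[of P] label_sources_input_free[of P]
      child_labels[OF that] parent_not_singleton[OF that] by blast
  then have "in_out F ` {P. label_child D S P \<and> input_free F P} - removed =
      in_out F ` fed_parents D S"
    by blast
  then show ?thesis
    unfolding in_neighbours_star[OF in_head_not_removed[OF assms]] pre_wires_into_in_head Un_Diff
    by auto
qed

lemma in_neighbours_input_gate:
  assumes "is_Input_Gate (kind F g)"
  shows "in_neighbours star (Orig g) = {}"
proof -
  have "\<not> input_free F S" if "{g} \<subseteq> S" for S using assms that by (auto simp: input_free_def)
  then have "pre_inputs (in_head F {g}) = {}"
    unfolding pre_wires_into_in_head using child_psubset arc_target_input_free by blast
  then show ?thesis using in_neighbours_star[of "Orig g"] by (simp add: in_head_def)
qed

lemma in_neighbours_in_head_nonempty: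
  assumes "S \<in> scd_labels D" "label_sources D S \<noteq> {}"
  shows "in_neighbours star (in_head F S) \<noteq> {}"
  using label_sources_eq_Union_fed[of D S] assms(2)
  unfolding in_neighbours_in_head[OF assms] by blast

text \<open>
  A NOT gate has a single incoming wire in \<open>F\<close>, counted with multiplicity, so at most one adjacency
  operation targets a label containing it, and the source label of that operation is a singleton.
\<close>

lemma not_label_arc_unique:
  assumes "S \<in> scd_labels D" "has_kind F S Not_Gate"
    and "label_arc D S1 T1" "S \<subseteq> T1" "label_arc D S2 T2" "S \<subseteq> T2"
  shows "S1 = S2 \<and> T1 = T2 \<and> is_singleton S1"
proof -
  obtain g where g: "g \<in> S" using label_nonempty assms(1) by blast
  then have fan_in: "fan_in F g = 1"
    using fan_in_ok_F[of g] label_subset_gates[OF assms(1)] assms(2)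
    by (auto simp: has_kind_iff)
  then obtain x where "in_neighbours F g = {x}"
    using is_singleton_in_neighbours[of F g] by (auto simp: is_singleton_def)
  then have "S1 \<subseteq> {x}" "S2 \<subseteq> {x}"
    using g assms wire_iff_label_arc[of _ g] unfolding in_neighbours_def by blast+
  moreover have "S1 \<noteq> {}" "S2 \<noteq> {}" using arc_labels assms label_nonempty by blast+
  ultimately have S: "S1 = {x}" "S2 = {x}" by auto
  have "T1 = T2"
  proof (rule ccontr)
    assume "T1 \<noteq> T2"
    then have "count (arcs (graph_at D)) (x, g) \<ge> 2"
      using count_arcs_ge_two[OF valid assms(3,5), of x g] S g assms by auto
    then have "count (wires F) (x, g) \<ge> 2" using scd_F by (simp add: scd_of_def)
    then show False using count_wires_le_fan_in[of F x g] fan_in by simp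
  qed
  then show ?thesis using S by simp
qed

lemma is_singleton_in_neighbours_not_label:
  assumes "S \<in> scd_labels D" "has_kind F S Not_Gate" "label_sources D S \<noteq> {}"
  shows "is_singleton (in_neighbours star (in_head F S))"
proof -
  note arc_unique = not_label_arc_unique[OF assms(1,2)]
  have no_arc: "\<not> label_arc D S1 S" if P: "label_child D S P" "label_sources D P \<noteq> {}" for P S1
  proof
    assume arc: "label_arc D S1 S"
    obtain S2 T where T: "label_arc D S2 T" "label_descendant D P T"
      using P by (auto simp: label_sources_def)
    have "S \<subset> T" using child_psubset[OF P(1)] label_descendant_subset[OF valid T(2)] by blast
    then show False using arc_unique[OF arc _ T(1)] by blast
  qed
  show ?thesis
  proof (rule is_singletonI')
    show "in_neighbours star (in_head F S) \<noteq> {}"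
      by (rule in_neighbours_in_head_nonempty[OF assms(1,3)])
    fix h h' assume "h \<in> in_neighbours star (in_head F S)" "h' \<in> in_neighbours star (in_head F S)"
    then show "h = h'"
      using no_arc label_parent_unique[OF valid, of S] arc_unique
      unfolding in_neighbours_in_head[OF assms(1,3)] by blast
  qed
qed


section \<open>Values\<close>

fun star_value :: "('g \<Rightarrow> bool) \<Rightarrow> 'g star_gate \<Rightarrow> bool" where
  "star_value v (Orig g) \<longleftrightarrow> v g"
| "star_value v (Oand_Gate S) \<longleftrightarrow> junction (star_kind F (Oand_Gate S)) (v ` S)"
| "star_value v (Oor_Gate S) \<longleftrightarrow> junction (star_kind F (Oor_Gate S)) (v ` S)"
| "star_value v (In_Gate S) \<longleftrightarrow> junction (star_kind F (In_Gate S)) (v ` label_sources D S)"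
| "star_value v (In_Not1 S) \<longleftrightarrow> \<not> junction (star_kind F (In_Not1 S)) (v ` label_sources D S)"
| "star_value v (In_Not2 S) \<longleftrightarrow> junction (star_kind F (In_Not2 S)) (v ` label_sources D S)"

lemma star_value_oand: "star_value v (oand S) \<longleftrightarrow> junction (And_Gate :: 'x gate_kind) (v ` S)"
  by (auto simp: oand_def is_singleton_def)

lemma star_value_oor: "star_value v (oor S) \<longleftrightarrow> junction (Or_Gate :: 'x gate_kind) (v ` S)"
  by (auto simp: oor_def is_singleton_def)

lemma star_value_in_out:
  assumes "\<not> is_singleton S" "has_kind F S k" "\<not> is_Input_Gate k"
  shows "star_value v (in_out F S) \<longleftrightarrow> junction k (v ` label_sources D S)"
  using assms(1,3) label_type_iff_kind[OF assms(2)] by (cases k) (simp_all add: in_out_def)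

lemma star_value_in_head:
  fixes \<alpha> :: "'x \<Rightarrow> bool"
  defines "v \<equiv> gate_value F \<alpha>"
  assumes "S \<in> scd_labels D" "has_kind F S k" "\<not> is_Input_Gate k"
  shows "star_value v (in_head F S) \<longleftrightarrow> gate_op \<alpha> k (v ` label_sources D S)"
proof (cases "is_singleton S")
  case True
  then obtain g where g: "S = {g}" by (auto simp: is_singleton_def)
  then have "g \<in> gates F" using assms(2) singleton_label_iff by blast
  then have "v g = gate_op \<alpha> (kind F g) (v ` in_neighbours F g)"
    unfolding v_def by (rule gate_value_eq_gate_op[OF wf_F])
  then show ?thesis using g assms(3)
    by (simp add: in_head_def label_sources_singleton_in_neighbours)
next
  case False
  then show ?thesis
    using assms(4) label_type_iff_kind[OF assms(3)]
    by (cases k) (simp_all add: in_head_def gate_op_def)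
qed

lemma star_value_arc_gate:
  assumes "label_arc D S T" "has_kind F T k"
  shows "star_value v (arc_gate F ch S T) \<longleftrightarrow> junction k (v ` S)"
proof (cases k)
  case Not_Gate
  then have "is_singleton S"
    using not_label_arc_unique[of T S T S T] arc_labels[OF assms(1)] assms by auto
  then obtain x where "S = {x}" by (auto simp: is_singleton_def)
  then show ?thesis by (simp add: arc_gate_def star_value_oand star_value_oor)
next
  case (Input_Gate x)
  then show ?thesis
    using arc_target_input_free[OF assms(1)] label_type_iff_kind(5)[OF assms(2)] by simp
qed (use arc_gate_eq[OF assms(1)] label_type_iff_kind[OF assms(2)] in
    \<open>simp_all add: star_value_oand star_value_oor\<close>)

lemma junction_children:
  assumes "S \<in> scd_labels D" "\<not> is_singleton S"
  shows "junction k ((\<lambda>S'. junction k (v ` S')) ` label_children D S) \<longleftrightarrow> junction k (v ` S)"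
  by (simp only: junction_image_junction Union_label_children[OF valid assms])

lemma junction_in_neighbours_in_head:
  assumes "S \<in> scd_labels D" "has_kind F S k" "label_sources D S \<noteq> {}"
  shows "junction k (star_value v ` in_neighbours star (in_head F S)) \<longleftrightarrow>
    junction k (v ` label_sources D S)"
proof -
  have parent: "star_value v (in_out F P) = junction k (v ` label_sources D P)"
    if "P \<in> fed_parents D S" for P
  proof -
    have "has_kind F P k" using that parent_has_kind label_sources_input_free assms(2) by blast
    then show ?thesis
      using that star_value_in_out parent_not_singleton label_sources_input_free
        label_type_iff_kind(5) by blast
  qed
  have "star_value v ` in_neighbours star (in_head F S) =
      (\<lambda>P. star_value v (in_out F P)) ` fed_parents D S \<union>
      (\<lambda>S1. star_value v (arc_gate F ch S1 S)) ` arc_tails D S"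
    unfolding in_neighbours_in_head[OF assms(1,3)] by (simp add: image_Un image_image)
  also have "\<dots> = (\<lambda>X. junction k (v ` X)) ` (label_sources D ` fed_parents D S \<union> arc_tails D S)"
    using parent star_value_arc_gate[OF _ assms(2)] by (simp add: image_Un image_image)
  finally show ?thesis by (simp only: junction_image_junction label_sources_eq_Union_fed[of D S])
qed


section \<open>Acyclicity\<close>

text \<open>
  Here \<open>r\<close> is a topological rank of \<open>F\<close>. The second component orders the wires inside the label
  tree, which lead upwards through \<open>oand\<close> and \<open>oor\<close> and downwards through \<open>in\<close>; the factor 2 leaves
  room for the second gate of a NOT chain.
\<close>

fun star_rank :: "('g \<Rightarrow> nat) \<Rightarrow> 'g star_gate \<Rightarrow> nat \<times> int" where
  "star_rank r (Orig g) = (r g, 1)"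
| "star_rank r (Oand_Gate S) = (Max (r ` S), int (card S))"
| "star_rank r (Oor_Gate S) = (Max (r ` S), int (card S))"
| "star_rank r (In_Gate S) = (Min (r ` S), - 2 * int (card S))"
| "star_rank r (In_Not1 S) = (Min (r ` S), - 2 * int (card S))"
| "star_rank r (In_Not2 S) = (Min (r ` S), - 2 * int (card S) + 1)"

lemma star_rank_oand: "star_rank r (oand S) = (Max (r ` S), int (card S))"
  by (auto simp: oand_def is_singleton_def)

lemma star_rank_oor: "star_rank r (oor S) = (Max (r ` S), int (card S))"
  by (auto simp: oor_def is_singleton_def)

lemma star_rank_in_head: "(Min (r ` S), - 2 * int (card S)) \<le> star_rank r (in_head F S)"
  by (auto simp: in_head_def is_singleton_def)

lemma star_rank_in_out:
  assumes "\<not> is_singleton S"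
  shows "star_rank r (in_out F S) \<le> (Min (r ` S), - 2 * int (card S) + 1)"
  using assms by (simp add: in_out_def)

lemma child_Max_Min_rank:
  fixes r :: "'g \<Rightarrow> nat"
  assumes "label_child D S P"
  shows "Max (r ` S) \<le> Max (r ` P)" and "Min (r ` P) \<le> Min (r ` S)"
proof -
  have "finite P" "S \<noteq> {}" "S \<subset> P"
    using child_psubset[OF assms] child_labels[OF assms] label_finite label_nonempty by auto
  then show "Max (r ` S) \<le> Max (r ` P)" and "Min (r ` P) \<le> Min (r ` S)"
    by (auto intro!: Max_mono Min_antimono)
qed

lemma child_card_less: "label_child D S P \<Longrightarrow> card S < card P"
  by (rule psubset_card_mono) (auto dest: child_labels child_psubset label_finite)

lemma star_rank_arc_gate_less:
  fixes r :: "'g \<Rightarrow> nat"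
  assumes "\<And>h g. (h, g) \<in># wires F \<Longrightarrow> r h < r g" "label_arc D S T"
  shows "star_rank r (arc_gate F ch S T) < star_rank r (in_head F T)"
proof -
  have "finite S" "S \<noteq> {}" "finite T" "T \<noteq> {}"
    using arc_labels[OF assms(2)] label_finite label_nonempty by auto
  then have "Max (r ` S) < Min (r ` T)"
    using assms wire_iff_label_arc by (auto simp: Max_less_iff)
  then have "star_rank r (arc_gate F ch S T) < (Min (r ` T), - 2 * int (card T))"
    by (simp add: arc_gate_def star_rank_oand star_rank_oor)
  also have "\<dots> \<le> star_rank r (in_head F T)" by (rule star_rank_in_head)
  finally show ?thesis .
qed

lemma star_rank_in_out_less:
  assumes "label_child D S P"
  shows "star_rank r (in_out F P) < star_rank r (in_head F S)"
proof -
  have "star_rank r (in_out F P) \<le> (Min (r ` P), - 2 * int (card P) + 1)"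
    by (rule star_rank_in_out[OF parent_not_singleton[OF assms]])
  also have "\<dots> < (Min (r ` S), - 2 * int (card S))"
    using child_Max_Min_rank(2)[OF assms] child_card_less[OF assms] by auto
  also have "\<dots> \<le> star_rank r (in_head F S)" by (rule star_rank_in_head)
  finally show ?thesis .
qed

lemma acyclic_pre_wires: "acyclic (pre_wires F D ch)"
proof -
  obtain r :: "'g \<Rightarrow> nat" where r: "\<And>h g. (h, g) \<in># wires F \<Longrightarrow> r h < r g"
    using finite_acyclic_rank[of "set_mset (wires F)"] wf_F
    by (auto simp: well_formed_circuit_def)
  have "star_rank r h < star_rank r h'" if "(h, h') \<in> pre_wires F D ch" for h h'
    using that
  proof cases
    case (child_parent_and S1 S2)
    then show ?thesis using child_Max_Min_rank(1)[of S1 S2 r] child_card_less[of S1 S2]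
      by (auto simp: star_rank_oand)
  next
    case (child_parent_or S1 S2)
    then show ?thesis using child_Max_Min_rank(1)[of S1 S2 r] child_card_less[of S1 S2]
      by (auto simp: star_rank_oor)
  next
    case (adjacency_and S1 S2)
    then show ?thesis
      using star_rank_arc_gate_less[OF r adjacency_and(3)] arc_gate_eq(1)[of S1 S2] by simp
  next
    case (adjacency_or S1 S2)
    then show ?thesis
      using star_rank_arc_gate_less[OF r adjacency_or(3)] arc_gate_eq(2)[of S1 S2] by simp
  next
    case (adjacency_not S1 S2)
    then show ?thesis
      using star_rank_arc_gate_less[OF r adjacency_not(3)] arc_gate_eq(3)[of S1 S2] by simp
  qed (simp_all add: star_rank_in_out_less)
  then have "acyclic ((pre_wires F D ch)\<inverse>)" by (intro acyclicI_order[of _ "star_rank r"]) simp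
  then show ?thesis by simp
qed


section \<open>Correctness\<close>

lemma star_gate_cases:
  assumes "h \<in> gates star"
  obtains (input) g x where "h = Orig g" "g \<in> gates F" "kind F g = Input_Gate x"
  | (oand) S where "h = Oand_Gate S" "S \<in> scd_labels D" "\<not> is_singleton S"
  | (oor) S where "h = Oor_Gate S" "S \<in> scd_labels D" "\<not> is_singleton S"
  | (in_head) S k where "h = in_head F S" "S \<in> scd_labels D" "label_sources D S \<noteq> {}"
      "has_kind F S k" "\<not> is_Input_Gate k"
  | (in_not2) S where "h = In_Not2 S" "S \<in> scd_labels D" "\<not> is_singleton S" "unary_label F S"
      "label_sources D S \<noteq> {}"
proof -
  have live_head: thesis if "h = in_head F S" "S \<in> scd_labels D" "label_sources D S \<noteq> {}" for S
    using in_head[OF that]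
      input_free_has_kind[OF valid typed that(2) label_sources_input_free[OF that(3)]] by blast
  have h: "h \<in> pre_gates F D" "h \<notin> removed" using assms by (auto simp: gates_star)
  then consider (orig) g where "h = Orig g" "{g} \<in> scd_labels D"
    | (oand) S where "h = Oand_Gate S" "S \<in> scd_labels D" "\<not> is_singleton S"
    | (oor) S where "h = Oor_Gate S" "S \<in> scd_labels D" "\<not> is_singleton S"
    | (inner) S where "S \<in> scd_labels D" "\<not> is_singleton S" "input_free F S"
      "h = in_head F S \<or> h = in_out F S"
    unfolding pre_gates_def in_gates_def by blast
  then show thesis
  proof cases
    case (orig g)
    then have g: "g \<in> gates F" using singleton_label_iff by blast
    show thesis
    proof (cases "is_Input_Gate (kind F g)")
      case True
      then show thesis using input[OF orig(1) g] by (auto simp: is_Input_Gate_def)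
    next
      case False
      then have "fan_in F g > 0" using fan_in_ok_F[OF g] by (cases "kind F g") auto
      then have "label_sources D {g} \<noteq> {}"
        by (simp add: label_sources_singleton_in_neighbours fan_in_pos_iff)
      then show thesis using live_head[of "{g}"] orig by (simp add: in_head_def)
    qed
  next
    case (inner S)
    then have "label_sources D S \<noteq> {}"
      using in_head_removed_iff in_out_removed_iff h(2) by blast
    then show thesis
      using inner live_head[of S] in_not2[of S]
      by (auto simp: in_head_def in_out_def split: if_splits)
  qed (use oand oor in blast)+
qed

lemma fan_in_ok_star:
  assumes "h \<in> gates star"
  shows "fan_in_ok (kind star h) (fan_in star h)"
  using assms
proof (cases rule: star_gate_cases)
  case (input g x)
  then show ?thesis using in_neighbours_input_gate[of g] by (simp add: kind_star fan_in_star)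
next
  case (oand S)
  then show ?thesis
    using label_children_nonempty[OF valid oand(2,3)]
    by (simp add: kind_star fan_in_pos_iff in_neighbours_out_gates)
next
  case (oor S)
  then show ?thesis
    using label_children_nonempty[OF valid oor(2,3)]
    by (simp add: kind_star fan_in_pos_iff in_neighbours_out_gates)
next
  case (in_head S k)
  have kind: "kind star h = k" using in_head star_kind_in_head by (simp add: kind_star)
  have "fan_in star h > 0"
    unfolding fan_in_pos_iff using in_neighbours_in_head_nonempty in_head by simp
  moreover have "fan_in star h = 1" if "k = Not_Gate"
    using is_singleton_in_neighbours_not_label in_head that
    by (simp add: fan_in_star is_singleton_altdef)
  ultimately show ?thesis using kind in_head(5) by (cases k) auto
next
  case (in_not2 S)
  then show ?thesis using in_neighbours_In_Not2[of S] by (simp add: kind_star fan_in_star)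
qed

lemma well_formed_star: "well_formed_circuit star"
  unfolding well_formed_circuit_def
proof (intro conjI ballI)
  show "finite (gates star)" using finite_pre_gates by (simp add: gates_star)
  show "set_mset (wires star) \<subseteq> gates star \<times> gates star"
    using pre_wires_subset unfolding set_wires_star gates_star by (auto simp: star_wires_def)
  show "acyclic (set_mset (wires star))"
    unfolding set_wires_star
    by (rule acyclic_subset[OF acyclic_pre_wires]) (auto simp: star_wires_def)
qed (rule fan_in_ok_star)

lemma star_value_eq_gate_op:
  fixes \<alpha> :: "'x \<Rightarrow> bool"
  defines "v \<equiv> gate_value F \<alpha>"
  assumes "h \<in> gates star"
  shows "star_value v h = gate_op \<alpha> (kind star h) (star_value v ` in_neighbours star h)"
  using assms(2)
proof (cases rule: star_gate_cases)
  case (input g x)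
  then show ?thesis
    using gate_value_eq_gate_op[OF wf_F, of g \<alpha>] by (simp add: v_def kind_star gate_op_def)
next
  case (oand S)
  then show ?thesis
    by (simp add: kind_star gate_op_def in_neighbours_out_gates star_value_oand image_image
        junction_children)
next
  case (oor S)
  then show ?thesis
    by (simp add: kind_star gate_op_def in_neighbours_out_gates star_value_oor image_image
        junction_children)
next
  case (in_head S k)
  have kind: "kind star h = k" using in_head star_kind_in_head by (simp add: kind_star)
  have "star_value v h \<longleftrightarrow> gate_op \<alpha> k (v ` label_sources D S)"
    using star_value_in_head in_head unfolding v_def by simp
  also have "\<dots> \<longleftrightarrow> gate_op \<alpha> k (star_value v ` in_neighbours star h)"
    using junction_in_neighbours_in_head in_head by (intro gate_op_cong) simp
  finally show ?thesis using kind by simp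
next
  case (in_not2 S)
  then show ?thesis using in_neighbours_In_Not2[of S] by (simp add: kind_star gate_op_def)
qed

lemma Orig_in_gates_star: "Orig g \<in> gates star \<longleftrightarrow> g \<in> gates F"
  by (auto simp: gates_star pre_gates_def singleton_label_iff)

lemma input_gates_star: "input_gates star = Orig ` input_gates F"
proof -
  have "\<exists>g. h = Orig g" if "is_Input_Gate (star_kind F h)" for h
    using that by (cases h) (auto split: if_splits)
  then show ?thesis
    unfolding input_gates_def kind_star using Orig_in_gates_star by fastforce
qed

lemma gate_function_star:
  assumes "g \<in> gates F"
  shows "gate_function star (Orig g) = gate_function F g"
proof
  fix \<alpha>
  have "gate_value star \<alpha> (Orig g) = star_value (gate_value F \<alpha>) (Orig g)"
    using gate_value_unique[OF well_formed_star star_value_eq_gate_op] Orig_in_gates_star assms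
    by blast
  then show "gate_function star (Orig g) \<alpha> = gate_function F g \<alpha>" by (simp add: gate_function_def)
qed

end

theorem theorem2:
  fixes F :: "('g, 'x) circuit"
    and D :: "'g scd"
    and ch :: "'g set \<Rightarrow> 'g set \<Rightarrow> bool"
  assumes "well_formed_circuit F"
    and "scd_of D F"
    and "type_respecting F D"
  shows "well_formed_circuit (star_circuit F D ch) \<and>
    input_gates (star_circuit F D ch) = Orig ` input_gates F \<and>
    (\<forall>g. Orig g \<in> gates (star_circuit F D ch) \<longleftrightarrow> g \<in> gates F) \<and>
    (\<forall>g\<in>gates F. gate_function (star_circuit F D ch) (Orig g) = gate_function F g)"
proof -
  interpret decomposed_circuit F D ch using assms by unfold_locales
  show ?thesis
    using well_formed_star input_gates_star Orig_in_gates_star gate_function_star by blast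
qed

end
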